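(* Let $f:2^N\to\mathbb{R}$ be a monotone subadditive function with $f(\emptyset)=0$ on a finite ground set $N$ of size $n$, with a known weak submodular order $\pi$, and let $\mathcal{I}$ be the family of independent sets of a matroid on $N$ of rank $d\ge1$. Then the algorithm Matroid-Local-Search described in the context outputs a set $S\in\mathcal{I}$ with $$f(S)\;\ge\;0.25\,\max_{T\in\mathcal{I}}f(T),$$ and its query complexity is $O(nd)$.
   Context: Notation: $f(X\mid S)=f(X\cup S)-f(S)$, and $f(e\mid S)=f(\{e\}\mid S)$. $f$ is monotone if $f(A)\ge f(B)$ whenever $B\subseteq A$, and subadditive if $f(A)+f(B)\ge f(A\cup B)$ for all $A,B$. Queries are made to oracles returning $f(S)$ and testing whether $S\in\mathcal{I}$. For a permutation $\pi$ of $N$, viewed as a left-to-right ordering, $l_\pi(S)$ and $r_\pi(S)$ denote the leftmost and rightmost elements of $S$ (inequalities compare positions in $\pi$ and are vacuous for empty sets). Sets $B\subseteq A$ are $\pi$-nested if $l_\pi(A\setminus B)>r_\pi(B)$. The permutation $\pi$ is a weak submodular order for $f$ if $f(C\mid A)\le f(C\mid B)$ for all $\pi$-nested $B\subseteq A$ and every $C$ with $l_\pi(C)>r_\pi(A)$. Algorithm Matroid-Local-Search: index $N=\{1,\dots,n\}$ in the order $\pi$. Initialize $S=R=\emptyset$ and $v_j=0$ for all $j$. For $j=1,2,\dots,n$: - if $S\cup\{j\}\in\mathcal{I}$, set $v_j=f(j\mid S\cup R)$ and replace $S$ by $S\cup\{j\}$; - otherwise, let $C$ be the circuit in $S\cup\{j\}$,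 let $i^*\in\arg\min_{i\in C\setminus\{j\}}v_i$ and $v_C=v_{i^*}$; if $f(j\mid S\cup R)>v_C$, set $v_j=v_C+f(j\mid S\cup R)$ (with $S,R$ before the update), replace $S$ by $(S\setminus\{i^*\})\cup\{j\}$ and replace $R$ by $R\cup\{i^*\}$; else leave $S,R$ unchanged. (If $C=\{j\}$ is a loop, $j$ is rejected.) Output $S$. *)

theory Defs
  imports Complex_Main "HOL-Combinatorics.Multiset_Permutations" "HOL-Library.Monad_Syntax"
begin

definition marginal :: "('a set \<Rightarrow> real) \<Rightarrow> 'a set \<Rightarrow> 'a set \<Rightarrow> real" where
  "marginal f X S = f (X \<union> S) - f S"

definition subadditive_on :: "'a set \<Rightarrow> ('a set \<Rightarrow> real) \<Rightarrow> bool" where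
  "subadditive_on N f \<longleftrightarrow> (\<forall>A B. A \<subseteq> N \<longrightarrow> B \<subseteq> N \<longrightarrow> f (A \<union> B) \<le> f A + f B)"

text \<open>A permutation of the ground set is a duplicate-free list, read from left to right.\<close>

definition pos :: "'a list \<Rightarrow> 'a \<Rightarrow> nat" where
  "pos \<pi> x = (THE i. i < length \<pi> \<and> \<pi> ! i = x)"

definition leftmost :: "'a list \<Rightarrow> 'a set \<Rightarrow> 'a" where
  "leftmost \<pi> S = (ARG_MIN (pos \<pi>) x. x \<in> S)"

definition rightmost :: "'a list \<Rightarrow> 'a set \<Rightarrow> 'a" where
  "rightmost \<pi> S = (ARG_MAX (pos \<pi>) x. x \<in> S)"

text \<open>The inequality \<open>l\<^sub>\<pi>(A) > r\<^sub>\<pi>(B)\<close>, vacuously true if one of the sets is empty.\<close>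

definition right_of :: "'a list \<Rightarrow> 'a set \<Rightarrow> 'a set \<Rightarrow> bool" where
  "right_of \<pi> A B \<longleftrightarrow>
     (A \<noteq> {} \<longrightarrow> B \<noteq> {} \<longrightarrow> pos \<pi> (leftmost \<pi> A) > pos \<pi> (rightmost \<pi> B))"

definition nested :: "'a list \<Rightarrow> 'a set \<Rightarrow> 'a set \<Rightarrow> bool" where
  "nested \<pi> B A \<longleftrightarrow> B \<subseteq> A \<and> right_of \<pi> (A - B) B"

definition weak_submodular_order :: "'a set \<Rightarrow> ('a set \<Rightarrow> real) \<Rightarrow> 'a list \<Rightarrow> bool" where
  "weak_submodular_order N f \<pi> \<longleftrightarrow>
     \<pi> \<in> permutations_of_set N \<and>
     (\<forall>A B C. A \<subseteq> N \<longrightarrow> C \<subseteq> N \<longrightarrow> nested \<pi> B A \<longrightarrow> right_of \<pi> C A \<longrightarrow>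
        marginal f C A \<le> marginal f C B)"

definition matroid :: "'a set \<Rightarrow> 'a set set \<Rightarrow> bool" where
  "matroid N I \<longleftrightarrow>
     finite N \<and> I \<subseteq> Pow N \<and> {} \<in> I \<and>
     (\<forall>A\<in>I. \<forall>B. B \<subseteq> A \<longrightarrow> B \<in> I) \<and>
     (\<forall>A\<in>I. \<forall>B\<in>I. card A < card B \<longrightarrow> (\<exists>x\<in>B - A. insert x A \<in> I))"

definition matroid_rank :: "'a set set \<Rightarrow> nat" where
  "matroid_rank I = Max (card ` I)"

definition circuit :: "'a set \<Rightarrow> 'a set set \<Rightarrow> 'a set \<Rightarrow> bool" where
  "circuit N I C \<longleftrightarrow> C \<subseteq> N \<and> C \<notin> I \<and> (\<forall>D. D \<subset> C \<longrightarrow> D \<in> I)"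

text \<open>A state is a triple \<open>(S, R, v)\<close>. Ties in the \<open>argmin\<close> may be broken arbitrarily, so
  the algorithm is a relation between initial and final states.\<close>

type_synonym 'a state = "'a set \<times> 'a set \<times> ('a \<Rightarrow> real)"

inductive mls_step :: "'a set \<Rightarrow> 'a set set \<Rightarrow> ('a set \<Rightarrow> real) \<Rightarrow> 'a \<Rightarrow> 'a state \<Rightarrow> 'a state \<Rightarrow> bool"
  for N I f j where
  add: "insert j S \<in> I \<Longrightarrow>
     mls_step N I f j (S, R, v) (insert j S, R, v(j := marginal f {j} (S \<union> R)))"
| swap: "insert j S \<notin> I \<Longrightarrow> circuit N I C \<Longrightarrow> C \<subseteq> insert j S \<Longrightarrow>
     is_arg_min v (\<lambda>i. i \<in> C - {j}) i \<Longrightarrow> marginal f {j} (S \<union> R) > v i \<Longrightarrow>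
     mls_step N I f j (S, R, v)
       (insert j (S - {i}), insert i R, v(j := v i + marginal f {j} (S \<union> R)))"
| reject: "insert j S \<notin> I \<Longrightarrow> circuit N I C \<Longrightarrow> C \<subseteq> insert j S \<Longrightarrow>
     is_arg_min v (\<lambda>i. i \<in> C - {j}) i \<Longrightarrow> \<not> marginal f {j} (S \<union> R) > v i \<Longrightarrow>
     mls_step N I f j (S, R, v) (S, R, v)"
| loop: "insert j S \<notin> I \<Longrightarrow> circuit N I {j} \<Longrightarrow> mls_step N I f j (S, R, v) (S, R, v)"

inductive mls_steps :: "'a set \<Rightarrow> 'a set set \<Rightarrow> ('a set \<Rightarrow> real) \<Rightarrow> 'a list \<Rightarrow> 'a state \<Rightarrow> 'a state \<Rightarrow> bool"
  for N I f where
  Nil: "mls_steps N I f [] s s"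
| Cons: "mls_step N I f j s s' \<Longrightarrow> mls_steps N I f js s' s'' \<Longrightarrow> mls_steps N I f (j # js) s s''"

definition mls_outputs :: "'a set \<Rightarrow> 'a set set \<Rightarrow> ('a set \<Rightarrow> real) \<Rightarrow> 'a list \<Rightarrow> 'a set set" where
  "mls_outputs N I f \<pi> = {S. \<exists>R v. mls_steps N I f \<pi> ({}, {}, \<lambda>_. 0) (S, R, v)}"

text \<open>A program has access to \<open>f\<close> and to the matroid only through the two kinds of queries.
  \<open>Choose A k\<close> continues with an arbitrary element of \<open>A\<close> and is not a query.\<close>

datatype ('a, 'r) prog =
    Return 'r
  | Query_Value "'a set" "real \<Rightarrow> ('a, 'r) prog"
  | Query_Indep "'a set" "bool \<Rightarrow> ('a, 'r) prog"
  | Choose "'a set" "'a \<Rightarrow> ('a, 'r) prog"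

primrec bind_prog :: "('a, 'r) prog \<Rightarrow> ('r \<Rightarrow> ('a, 's) prog) \<Rightarrow> ('a, 's) prog" where
  "bind_prog (Return r) g = g r"
| "bind_prog (Query_Value S k) g = Query_Value S (\<lambda>x. bind_prog (k x) g)"
| "bind_prog (Query_Indep S k) g = Query_Indep S (\<lambda>b. bind_prog (k b) g)"
| "bind_prog (Choose A k) g = Choose A (\<lambda>a. bind_prog (k a) g)"

adhoc_overloading Monad_Syntax.bind \<rightleftharpoons> bind_prog

text \<open>All possible results, each paired with the number of oracle queries made.\<close>

primrec outcomes :: "('a set \<Rightarrow> real) \<Rightarrow> 'a set set \<Rightarrow> ('a, 'r) prog \<Rightarrow> ('r \<times> nat) set" where
  "outcomes f I (Return r) = {(r, 0)}"
| "outcomes f I (Query_Value S k) = (\<lambda>(r, q). (r, Suc q)) ` outcomes f I (k (f S))"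
| "outcomes f I (Query_Indep S k) = (\<lambda>(r, q). (r, Suc q)) ` outcomes f I (k (S \<in> I))"
| "outcomes f I (Choose A k) = (\<Union>a\<in>A. outcomes f I (k a))"

definition query_marginal :: "'a \<Rightarrow> 'a set \<Rightarrow> ('a, real) prog" where
  "query_marginal j S = do {
     x \<leftarrow> Query_Value (insert j S) Return;
     y \<leftarrow> Query_Value S Return;
     Return (x - y)
   }"

text \<open>For \<open>S\<close> independent and \<open>S \<union> {j}\<close> dependent, the circuit in \<open>S \<union> {j}\<close> consists of \<open>j\<close> and
  those \<open>i \<in> S\<close> for which \<open>(S - {i}) \<union> {j}\<close> is independent; hence it can be found with one
  independence query per element of \<open>S\<close>. The first argument enumerates \<open>S\<close>.\<close>

primrec query_circuit :: "'a list \<Rightarrow> 'a \<Rightarrow> 'a set \<Rightarrow> ('a, 'a set) prog" where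
  "query_circuit [] j S = Return {j}"
| "query_circuit (i # is) j S = do {
     b \<leftarrow> Query_Indep (insert j (S - {i})) Return;
     C \<leftarrow> query_circuit is j S;
     Return (if b then insert i C else C)
   }"

definition mls_step_prog :: "'a list \<Rightarrow> 'a \<Rightarrow> 'a state \<Rightarrow> ('a, 'a state) prog" where
  "mls_step_prog \<pi> j = (\<lambda>(S, R, v). do {
     b \<leftarrow> Query_Indep (insert j S) Return;
     if b then do {
       g \<leftarrow> query_marginal j (S \<union> R);
       Return (insert j S, R, v(j := g))
     } else do {
       C \<leftarrow> query_circuit (filter (\<lambda>i. i \<in> S) \<pi>) j S;
       if C = {j} then Return (S, R, v)
       else do {
         i \<leftarrow> Choose {i. is_arg_min v (\<lambda>i. i \<in> C - {j}) i} Return;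
         g \<leftarrow> query_marginal j (S \<union> R);
         Return (if g > v i then (insert j (S - {i}), insert i R, v(j := v i + g)) else (S, R, v))
       }
     }
   })"

primrec mls_steps_prog :: "'a list \<Rightarrow> 'a list \<Rightarrow> 'a state \<Rightarrow> ('a, 'a state) prog" where
  "mls_steps_prog \<pi> [] s = Return s"
| "mls_steps_prog \<pi> (j # js) s = do { s' \<leftarrow> mls_step_prog \<pi> j s; mls_steps_prog \<pi> js s' }"

definition mls_prog :: "'a list \<Rightarrow> ('a, 'a set) prog" where
  "mls_prog \<pi> = do { s \<leftarrow> mls_steps_prog \<pi> \<pi> ({}, {}, \<lambda>_. 0); Return (fst s) }"

end

theory Submission
  imports Defs
begin

text \<open>
  Let \<open>A = S \<union> R\<close> be the set of all elements that the algorithm ever accepts, and for \<open>x \<in> A\<close> let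
  \<open>g x\<close> be the marginal value of \<open>x\<close> over the elements accepted before it. Then \<open>f A = sum g A\<close>.
  The value of an element that is displaced is passed on to the newcomer, so also \<open>f A = sum v S\<close>.
  The bound \<open>f T \<le> 4 * f S\<close> for independent \<open>T\<close> comes from \<open>f A \<le> 2 * f S\<close> and \<open>f T \<le> 2 * f A\<close>.

  \<^item> Deleting \<open>R\<close> from \<open>A\<close>, from right to left, costs at most \<open>sum g R\<close>: when \<open>r\<close> is deleted, the
    elements to its left are still exactly those accepted before it, and by weak submodularity the
    elements to its right are worth at least as much without \<open>r\<close> as with it. A newcomer displaces
    an element only if its marginal value exceeds the value of that element, so \<open>v x \<le> 2 * g x\<close> on
    \<open>S\<close>. Hence \<open>f A = sum v S \<le> 2 * sum g S\<close>, that is \<open>sum g R \<le> f A / 2\<close>, and \<open>f S \<ge> f A / 2\<close>.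

  \<^item> By monotonicity \<open>f T \<le> f (A \<union> T)\<close>. Deleting \<open>T - A\<close> from \<open>A \<union> T\<close>, now from left to right, costs
    for each element at most its marginal value over the elements accepted before it. As it was
    rejected, this is at most the threshold \<open>v\<^sub>C\<close> of its rejection. With these thresholds as the
    weights of the rejected elements and \<open>v\<close> as the weight of the accepted ones, the algorithm is
    the incremental construction of a maximum-weight independent set, in which each newcomer
    competes with the lightest element of the circuit that it closes. So the thresholds on \<open>T - A\<close>
    sum up to at most \<open>sum v S = f A\<close>, and \<open>f T \<le> 2 * f A\<close>.

  Both arguments are organised as invariants of a single pass: \<open>prices_removal\<close> and
  \<open>prices_addition\<close> for the deletions, \<open>heaviest\<close> for the matroid. \<open>certified\<close> combines them,
  \<open>certified_step\<close> shows that a step preserves it, and \<open>certified_guarantee\<close> draws the conclusion.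

  For the query complexity, \<open>fundamental_circuit_eq\<close> shows that independence queries for the sets
  \<open>(S - {i}) \<union> {j}\<close>, one for each of the at most \<open>d\<close> elements \<open>i\<close> of \<open>S\<close>, find the circuit; the
  remaining queries of a step are three at most.
\<close>

section \<open>Exchange in matroids\<close>

lemma matroid_finite: "matroid N I \<Longrightarrow> A \<in> I \<Longrightarrow> finite A"
  unfolding matroid_def by (meson PowD finite_subset subsetD)

lemma matroid_finite_indep: "matroid N I \<Longrightarrow> finite I"
  unfolding matroid_def by (meson finite_Pow_iff finite_subset)

lemma matroid_subset: "matroid N I \<Longrightarrow> A \<in> I \<Longrightarrow> B \<subseteq> A \<Longrightarrow> B \<in> I"
  unfolding matroid_def by blast

lemma matroid_augment:
  "matroid N I \<Longrightarrow> A \<in> I \<Longrightarrow> B \<in> I \<Longrightarrow> card A < card B \<Longrightarrow> \<exists>x\<in>B - A. insert x A \<in> I"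
  unfolding matroid_def by blast

lemma card_le_matroid_rank: "matroid N I \<Longrightarrow> A \<in> I \<Longrightarrow> card A \<le> matroid_rank I"
  unfolding matroid_rank_def by (simp add: matroid_finite_indep)

lemma matroid_extend:
  assumes M: "matroid N I" and "A \<in> I" "B \<in> I" "card A \<le> card B"
  shows "\<exists>D\<in>I. A \<subseteq> D \<and> D \<subseteq> A \<union> B \<and> card D = card B"
  using assms(2,4)
proof (induction "card B - card A" arbitrary: A)
  case 0
  then show ?case by auto
next
  case (Suc k)
  have "card A < card B" using Suc.hyps(2) by simp
  then obtain x where x: "x \<in> B - A" "insert x A \<in> I"
    using matroid_augment[OF M Suc.prems(1) \<open>B \<in> I\<close>] by blast
  have "card (insert x A) = Suc (card A)"
    using x matroid_finite[OF M Suc.prems(1)] by simp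
  then have "k = card B - card (insert x A)" "card (insert x A) \<le> card B"
    using Suc.hyps(2) by auto
  then obtain D where "D \<in> I" "insert x A \<subseteq> D" "D \<subseteq> insert x A \<union> B" "card D = card B"
    using Suc.hyps(1) x(2) by blast
  then show ?case using x by (intro bexI[of _ D]) auto
qed

lemma exists_circuit:
  assumes "finite A" "A \<subseteq> N" "A \<notin> I"
  shows "\<exists>C\<subseteq>A. circuit N I C"
  using assms
proof (induction A rule: finite_psubset_induct)
  case (psubset A)
  show ?case
  proof (cases "\<forall>D. D \<subset> A \<longrightarrow> D \<in> I")
    case True
    then show ?thesis using psubset by (auto simp: circuit_def)
  next
    case False
    then show ?thesis using psubset by (meson order.trans psubset_imp_subset)
  qed
qed

lemma circuit_contains_new:
  assumes "matroid N I" "S \<in> I" "circuit N I C" "C \<subseteq> insert j S"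
  shows "j \<in> C"
  using assms matroid_subset[of N I S C] by (auto simp: circuit_def)

text \<open>An independent \<open>D\<close> with \<open>C - {i} \<subseteq> D \<subseteq> S \<union> {j}\<close> and as many elements as \<open>S\<close> must omit \<open>i\<close>,
  since otherwise it would contain \<open>C\<close>; by cardinality it is then \<open>S - {i} \<union> {j}\<close>. In particular
  the circuit in \<open>S \<union> {j}\<close> is unique, and \<open>j\<close> can replace any of its other elements in \<open>S\<close>.\<close>

lemma fundamental_circuit_eq:
  assumes M: "matroid N I" and S: "S \<in> I" and C: "circuit N I C" "C \<subseteq> insert j S"
    and dep: "insert j S \<notin> I"
  shows "C = insert j {i \<in> S. insert j (S - {i}) \<in> I}"
proof
  have fS: "finite S" using matroid_finite[OF M S] .
  have jS: "j \<notin> S" using S dep by (auto simp: insert_absorb)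
  have jC: "j \<in> C" using circuit_contains_new[OF M S C] .
  show "C \<subseteq> insert j {i \<in> S. insert j (S - {i}) \<in> I}"
  proof
    fix i assume i: "i \<in> C"
    show "i \<in> insert j {i \<in> S. insert j (S - {i}) \<in> I}"
    proof (cases "i = j")
      case False
      then have iS: "i \<in> S" using i C by auto
      have "C - {i} \<in> I" using C i by (auto simp: circuit_def)
      moreover have "C - {i} \<subseteq> insert j (S - {i})" using C by auto
      then have "card (C - {i}) \<le> card (insert j (S - {i}))" using fS by (intro card_mono) auto
      then have "card (C - {i}) \<le> card S"
        using card_Suc_Diff1[OF fS iS] fS jS by simp
      ultimately obtain D where D: "D \<in> I" "C - {i} \<subseteq> D" "D \<subseteq> C - {i} \<union> S" "card D = card S"
        using matroid_extend[OF M _ S] by meson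
      have "i \<notin> D"
      proof
        assume "i \<in> D"
        then have "C \<subseteq> D" using D by auto
        then show False using C D(1) matroid_subset[OF M] by (auto simp: circuit_def)
      qed
      then have sub: "D \<subseteq> insert j (S - {i})" using D C by auto
      have "card (insert j (S - {i})) = card D"
        using card_Suc_Diff1[OF fS iS] fS jS D by simp
      then have "D = insert j (S - {i})" using sub fS by (simp add: card_subset_eq)
      then show ?thesis using D iS by simp
    qed simp
  qed
  show "insert j {i \<in> S. insert j (S - {i}) \<in> I} \<subseteq> C"
  proof
    fix i assume i: "i \<in> insert j {i \<in> S. insert j (S - {i}) \<in> I}"
    show "i \<in> C"
    proof (rule ccontr)
      assume "i \<notin> C"
      then have "C \<subseteq> insert j (S - {i})" "insert j (S - {i}) \<in> I" using i jC C by auto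
      then show False using C matroid_subset[OF M] by (auto simp: circuit_def)
    qed
  qed
qed

text \<open>In terms of closures: if \<open>T - {j}\<close> spanned \<open>C - {j}\<close>, it would span \<open>j\<close>, against the
  independence of \<open>T\<close>.\<close>

lemma circuit_exchange:
  assumes M: "matroid N I" and C: "circuit N I C" and j: "j \<in> C" "j \<in> T" and T: "T \<in> I"
  shows "\<exists>e\<in>C - {j}. e \<notin> T \<and> insert e (T - {j}) \<in> I"
proof -
  have fT: "finite T" using matroid_finite[OF M T] .
  have C': "C - {j} \<in> I" using C j by (auto simp: circuit_def)
  have T': "T - {j} \<in> I" using matroid_subset[OF M T] by auto
  have lt: "card (T - {j}) < card T" using fT j by (meson card_Diff1_less)
  obtain D where D: "D \<in> I" "j \<notin> D" "D \<subseteq> C \<union> T" "card (T - {j}) < card D"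
  proof (cases "card (C - {j}) \<le> card T")
    case True
    then obtain D where D: "D \<in> I" "C - {j} \<subseteq> D" "D \<subseteq> C - {j} \<union> T" "card D = card T"
      using matroid_extend[OF M C' T] by meson
    have "j \<notin> D"
    proof
      assume "j \<in> D"
      then have "C \<subseteq> D" using D by auto
      then show False using C D(1) matroid_subset[OF M] by (auto simp: circuit_def)
    qed
    then show ?thesis using D lt that[of D] by auto
  next
    case False
    then show ?thesis using C' lt that[of "C - {j}"] by auto
  qed
  obtain e where "e \<in> D - (T - {j})" "insert e (T - {j}) \<in> I"
    using matroid_augment[OF M T' D(1,4)] by blast
  then show ?thesis using D by auto
qed

text \<open>The invariant of the incremental construction of a maximum-weight independent set.\<close>

definition heaviest :: "'a set set \<Rightarrow> 'a set \<Rightarrow> ('a \<Rightarrow> real) \<Rightarrow> 'a set \<Rightarrow> bool" where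
  "heaviest I P w S \<longleftrightarrow> S \<in> I \<and> S \<subseteq> P \<and> (\<forall>T\<in>I. T \<subseteq> P \<longrightarrow> sum w T \<le> sum w S)"

lemma heaviest_add:
  assumes M: "matroid N I" and S: "heaviest I P w S" and j: "j \<notin> P" "insert j S \<in> I" "0 \<le> w j"
  shows "heaviest I (insert j P) w (insert j S)"
  unfolding heaviest_def
proof (intro conjI ballI impI)
  fix T assume T: "T \<in> I" "T \<subseteq> insert j P"
  have fS: "finite S" and fT: "finite T" using matroid_finite[OF M] S T by (auto simp: heaviest_def)
  have "sum w (T - {j}) \<le> sum w S"
    using S T matroid_subset[OF M T(1), of "T - {j}"] by (auto simp: heaviest_def)
  moreover have "sum w T \<le> sum w (T - {j}) + w j"
    using fT j by (cases "j \<in> T") (auto simp: sum.remove)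
  moreover have "j \<notin> S" using S j by (auto simp: heaviest_def)
  ultimately show "sum w T \<le> sum w (insert j S)" using fS by simp
qed (use S j in \<open>auto simp: heaviest_def\<close>)

text \<open>An independent set through \<open>j\<close> can trade \<open>j\<close> for another element of the circuit, which
  weighs at least as much as the lightest one; so it outweighs \<open>S\<close> at most by the difference
  between the weights of \<open>j\<close> and of the lightest element.\<close>

lemma heaviest_circuit_bound:
  assumes M: "matroid N I" and S: "heaviest I P w S" and C: "circuit N I C" "C \<subseteq> insert j S"
    and i: "is_arg_min w (\<lambda>i. i \<in> C - {j}) i" and ge: "w i \<le> w j"
    and T: "T \<in> I" "T \<subseteq> insert j P"
  shows "sum w T \<le> sum w S + (w j - w i)"
proof (cases "j \<in> T")
  case True
  have SI: "S \<in> I" "S \<subseteq> P" using S by (auto simp: heaviest_def)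
  have fT: "finite T" using matroid_finite[OF M T(1)] .
  have "j \<in> C" using circuit_contains_new[OF M SI(1) C] .
  then obtain e where e: "e \<in> C - {j}" "e \<notin> T" "insert e (T - {j}) \<in> I"
    using circuit_exchange[OF M C(1) _ True T(1)] by blast
  have "insert e (T - {j}) \<subseteq> P" using e C T SI by auto
  then have "sum w (insert e (T - {j})) \<le> sum w S"
    using S e(3) unfolding heaviest_def by blast
  moreover have "sum w (insert e (T - {j})) = sum w T - w j + w e"
    using e fT True by (simp add: sum_diff1)
  moreover have "w i \<le> w e" using i e by (simp add: is_arg_min_linorder)
  ultimately show ?thesis by simp
next
  case False
  then have "sum w T \<le> sum w S" using S T by (auto simp: heaviest_def)
  then show ?thesis using ge by simp
qed

lemma heaviest_swap:
  assumes M: "matroid N I" and S: "heaviest I P w S" and C: "circuit N I C" "C \<subseteq> insert j S"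
    and i: "is_arg_min w (\<lambda>i. i \<in> C - {j}) i" and ge: "w i \<le> w j"
    and j: "j \<notin> P" "insert j S \<notin> I"
  shows "heaviest I (insert j P) w (insert j (S - {i}))"
proof -
  have SI: "S \<in> I" "S \<subseteq> P" using S by (auto simp: heaviest_def)
  have iC: "i \<in> C - {j}" using i by (simp add: is_arg_min_def)
  then have iS: "i \<in> S" "insert j (S - {i}) \<in> I"
    using fundamental_circuit_eq[OF M SI(1) C j(2)] by auto
  have "sum w (insert j (S - {i})) = sum w S + (w j - w i)"
    using iS SI j matroid_finite[OF M SI(1)] by (subst sum.insert) (auto simp: sum_diff1)
  then show ?thesis
    using heaviest_circuit_bound[OF M S C i ge] iS SI by (auto simp: heaviest_def)
qed

lemma heaviest_reject:
  assumes M: "matroid N I" and S: "heaviest I P w S" and C: "circuit N I C" "C \<subseteq> insert j S"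
    and i: "is_arg_min w (\<lambda>i. i \<in> C - {j}) i" and "w j = w i"
  shows "heaviest I (insert j P) w S"
  using heaviest_circuit_bound[OF M S C i] S assms(6) by (auto simp: heaviest_def)

lemma heaviest_loop:
  assumes M: "matroid N I" and S: "heaviest I P w S" and C: "circuit N I {j}"
  shows "heaviest I (insert j P) w S"
proof -
  have "j \<notin> T" if "T \<in> I" for T
    using C matroid_subset[OF M that, of "{j}"] by (auto simp: circuit_def)
  then show ?thesis using S by (auto simp: heaviest_def subset_insert)
qed

lemma heaviest_cong:
  assumes "heaviest I P w S" "\<And>x. x \<in> P \<Longrightarrow> w' x = w x"
  shows "heaviest I P w' S"
proof -
  have "sum w' T = sum w T" if "T \<subseteq> P" for T
    using that assms(2) by (auto intro: sum.cong)
  then show ?thesis using assms(1) by (auto simp: heaviest_def)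
qed

section \<open>Weak submodular orders\<close>

lemma pos_nth: "distinct \<pi> \<Longrightarrow> i < length \<pi> \<Longrightarrow> pos \<pi> (\<pi> ! i) = i"
  unfolding pos_def by (rule the_equality) (auto simp: nth_eq_iff_index_eq)

lemma right_ofI:
  assumes "\<And>a b. a \<in> A \<Longrightarrow> b \<in> B \<Longrightarrow> pos \<pi> b < pos \<pi> a" "finite B"
  shows "right_of \<pi> A B"
  unfolding right_of_def
proof (intro impI)
  assume ne: "A \<noteq> {}" "B \<noteq> {}"
  have "leftmost \<pi> A \<in> A"
    using ne unfolding leftmost_def by (metis arg_min_natI ex_in_conv)
  moreover have "rightmost \<pi> B \<in> B"
  proof -
    obtain b where b: "b \<in> B" using ne by auto
    have "\<forall>y. y \<in> B \<longrightarrow> pos \<pi> y < Suc (Max (pos \<pi> ` B))"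
      using assms(2) by (auto simp: less_Suc_eq_le)
    then show ?thesis unfolding rightmost_def by (rule arg_max_natI[of "\<lambda>x. x \<in> B", OF b])
  qed
  ultimately show "pos \<pi> (rightmost \<pi> B) < pos \<pi> (leftmost \<pi> A)" using assms(1) by blast
qed

lemma right_of_append:
  assumes "distinct (xs @ ys)" "A \<subseteq> set xs" "C \<subseteq> set ys"
  shows "right_of (xs @ ys) C A"
proof (rule right_ofI)
  fix c a assume "c \<in> C" "a \<in> A"
  then have "a \<in> set xs" "c \<in> set ys" using assms by auto
  then obtain k m where km: "k < length xs" "a = xs ! k" "m < length ys" "c = ys ! m"
    by (metis in_set_conv_nth)
  have "pos (xs @ ys) a = k"
    using pos_nth[OF assms(1), of k] km by (simp add: nth_append)
  moreover have "pos (xs @ ys) c = length xs + m"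
    using pos_nth[OF assms(1), of "length xs + m"] km by (simp add: nth_append)
  ultimately show "pos (xs @ ys) a < pos (xs @ ys) c" using km by simp
qed (use assms in \<open>auto intro: finite_subset\<close>)

text \<open>As \<open>j\<close> lies between \<open>A\<close> and \<open>C\<close>, \<open>A\<close> is nested in \<open>insert j A\<close>, so \<open>C\<close> adds no more to
  \<open>insert j A\<close> than to \<open>A\<close>.\<close>

lemma weak_submodular_order_insert:
  assumes order: "weak_submodular_order N f (xs @ j # ys)" and A: "A \<subseteq> set xs" and C: "C \<subseteq> set ys"
  shows "f (insert j A \<union> C) \<le> f (A \<union> C) + marginal f {j} A"
proof -
  have d: "distinct (xs @ j # ys)" and N: "N = set (xs @ j # ys)"
    using order by (auto simp: weak_submodular_order_def permutations_of_set_def)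
  have "nested (xs @ j # ys) A (insert j A)"
    using right_of_append[OF d A, of "{j}"] d A
    by (auto simp: nested_def insert_Diff_if)
  moreover have "right_of (xs @ j # ys) C (insert j A)"
    using right_of_append[of "xs @ [j]" ys "insert j A" C] d A C by auto
  moreover have "insert j A \<subseteq> N" "C \<subseteq> N" using A C N by auto
  ultimately have "marginal f C (insert j A) \<le> marginal f C A"
    using order unfolding weak_submodular_order_def by blast
  then show ?thesis by (simp add: marginal_def Un_commute)
qed

text \<open>The two estimates below are maintained along the order: \<open>A\<close> lies in the part already read and
  \<open>F\<close> is the part still to come. Universal quantification over the sets \<open>C\<close> of later elements is
  what makes them inductive, because the next element \<open>j\<close> can first be counted as part of \<open>C\<close>.
  \<open>prices_removal\<close> bounds the loss when elements of \<open>A\<close> are deleted, \<open>prices_addition\<close> the gain when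
  rejected elements are put back.\<close>

definition prices_removal :: "('a set \<Rightarrow> real) \<Rightarrow> 'a set \<Rightarrow> ('a \<Rightarrow> real) \<Rightarrow> 'a set \<Rightarrow> bool" where
  "prices_removal f F g A \<longleftrightarrow> sum g A = f A \<and>
     (\<forall>X C. X \<subseteq> A \<longrightarrow> C \<subseteq> F \<longrightarrow> f (A \<union> C) \<le> f (A - X \<union> C) + sum g X)"

definition prices_addition ::
  "'a set set \<Rightarrow> ('a set \<Rightarrow> real) \<Rightarrow> 'a set \<Rightarrow> 'a set \<Rightarrow> ('a \<Rightarrow> real) \<Rightarrow> 'a set \<Rightarrow> bool" where
  "prices_addition I f P F w A \<longleftrightarrow>
     (\<forall>Q C. Q \<in> I \<longrightarrow> Q \<subseteq> P - A \<longrightarrow> C \<subseteq> F \<longrightarrow> f (A \<union> Q \<union> C) \<le> f (A \<union> C) + sum w Q)"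

lemma prices_removalD:
  "prices_removal f F g A \<Longrightarrow> X \<subseteq> A \<Longrightarrow> C \<subseteq> F \<Longrightarrow> f (A \<union> C) \<le> f (A - X \<union> C) + sum g X"
  unfolding prices_removal_def by blast

lemma prices_additionD:
  "prices_addition I f P F w A \<Longrightarrow> Q \<in> I \<Longrightarrow> Q \<subseteq> P - A \<Longrightarrow> C \<subseteq> F \<Longrightarrow>
     f (A \<union> Q \<union> C) \<le> f (A \<union> C) + sum w Q"
  unfolding prices_addition_def by blast

lemma prices_removal_accept:
  assumes order: "weak_submodular_order N f (xs @ j # ys)" and A: "A \<subseteq> set xs"
    and pr: "prices_removal f (set (j # ys)) g A"
  shows "prices_removal f (set ys) (g(j := marginal f {j} A)) (insert j A)"
  unfolding prices_removal_def
proof (intro conjI allI impI)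
  let ?g = "g(j := marginal f {j} A)"
  have jA: "j \<notin> A"
    using A order by (auto simp: weak_submodular_order_def permutations_of_set_def)
  have fA: "finite A" using A finite_subset by auto
  have g: "sum ?g X = sum g X" if "X \<subseteq> A" for X
    using that jA by (intro sum.cong) auto
  show "sum ?g (insert j A) = f (insert j A)"
    using fA jA g[of A] pr by (simp add: prices_removal_def marginal_def)
  fix X C assume X: "X \<subseteq> insert j A" and C: "C \<subseteq> set ys"
  show "f (insert j A \<union> C) \<le> f (insert j A - X \<union> C) + sum ?g X"
  proof (cases "j \<in> X")
    case True
    then have X': "X - {j} \<subseteq> A" using X by auto
    have "f (insert j A \<union> C) \<le> f (A \<union> C) + marginal f {j} A"
      using weak_submodular_order_insert[OF order A C] .
    also have "f (A \<union> C) \<le> f (A - (X - {j}) \<union> C) + sum g (X - {j})"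
      using C by (intro prices_removalD[OF pr X']) auto
    also have "A - (X - {j}) = insert j A - X" using True jA by auto
    also have "sum ?g X = marginal f {j} A + sum g (X - {j})"
      using True X fA g[OF X'] by (subst sum.remove[of _ j]) (auto intro: finite_subset)
    ultimately show ?thesis by simp
  next
    case False
    then have X': "X \<subseteq> A" using X by auto
    have "f (A \<union> insert j C) \<le> f (A - X \<union> insert j C) + sum g X"
      using C by (intro prices_removalD[OF pr X']) auto
    moreover have "insert j A - X \<union> C = A - X \<union> insert j C" using False by auto
    ultimately show ?thesis using g[OF X'] by simp
  qed
qed

lemma prices_addition_accept:
  assumes "prices_addition I f P (insert j F) w A" "j \<notin> P"
  shows "prices_addition I f (insert j P) F (w(j := x)) (insert j A)"
  unfolding prices_addition_def
proof (intro allI impI)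
  fix Q C assume Q: "Q \<in> I" "Q \<subseteq> insert j P - insert j A" and C: "C \<subseteq> F"
  have "sum (w(j := x)) Q = sum w Q" using Q by (intro sum.cong) auto
  moreover have "f (A \<union> Q \<union> insert j C) \<le> f (A \<union> insert j C) + sum w Q"
    using Q C assms(2) by (intro prices_additionD[OF assms(1)]) auto
  ultimately show "f (insert j A \<union> Q \<union> C) \<le> f (insert j A \<union> C) + sum (w(j := x)) Q"
    by simp
qed

lemma prices_addition_reject:
  assumes M: "matroid N I" and order: "weak_submodular_order N f (xs @ j # ys)"
    and A: "A \<subseteq> set xs" and pa: "prices_addition I f (set xs) (set (j # ys)) w A"
    and x: "{j} \<in> I \<Longrightarrow> marginal f {j} A \<le> x"
  shows "prices_addition I f (insert j (set xs)) (set ys) (w(j := x)) A"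
  unfolding prices_addition_def
proof (intro allI impI)
  fix Q C assume Q: "Q \<in> I" "Q \<subseteq> insert j (set xs) - A" and C: "C \<subseteq> set ys"
  have Q': "Q - {j} \<in> I" "Q - {j} \<subseteq> set xs - A" using Q matroid_subset[OF M] by auto
  have w: "sum (w(j := x)) (Q - {j}) = sum w (Q - {j})" by (intro sum.cong) auto
  show "f (A \<union> Q \<union> C) \<le> f (A \<union> C) + sum (w(j := x)) Q"
  proof (cases "j \<in> Q")
    case True
    have "f (A \<union> (Q - {j}) \<union> insert j C) \<le> f (A \<union> insert j C) + sum w (Q - {j})"
      using C by (intro prices_additionD[OF pa Q']) auto
    moreover have "A \<union> (Q - {j}) \<union> insert j C = A \<union> Q \<union> C" using True by auto
    moreover have "f (insert j A \<union> C) \<le> f (A \<union> C) + marginal f {j} A"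
      using weak_submodular_order_insert[OF order A C] .
    moreover have "marginal f {j} A \<le> x"
      using x True Q matroid_subset[OF M Q(1), of "{j}"] by auto
    moreover have "sum (w(j := x)) Q = x + sum w (Q - {j})"
      using True matroid_finite[OF M Q(1)] w by (subst sum.remove[of _ j]) auto
    ultimately show ?thesis by simp
  next
    case False
    then show ?thesis
      using prices_additionD[OF pa Q', of C] C w by auto
  qed
qed

section \<open>The approximation guarantee\<close>

text \<open>Here \<open>xs\<close> has been processed and \<open>ys\<close> is still to come. As witness for \<open>g\<close> serves the function
  that records the marginal value of each accepted element at the time of its acceptance. The
  weight \<open>w\<close> cannot be \<open>v\<close> itself, which stays 0 on rejected elements: the witness gives a rejected
  element the threshold that it failed to exceed, and a loop the weight 0.\<close>

definition certified :: "'a set set \<Rightarrow> ('a set \<Rightarrow> real) \<Rightarrow> 'a list \<Rightarrow> 'a list \<Rightarrow> 'a state \<Rightarrow> bool" where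
  "certified I f xs ys = (\<lambda>(S, R, v). \<exists>g w.
     R \<subseteq> set xs \<and> heaviest I (set xs) w S \<and> (\<forall>x\<in>S. w x = v x \<and> v x \<le> 2 * g x) \<and>
     sum v S = f (S \<union> R) \<and>
     prices_removal f (set ys) g (S \<union> R) \<and> prices_addition I f (set xs) (set ys) w (S \<union> R))"

lemma certifiedI:
  assumes "R \<subseteq> set xs" "heaviest I (set xs) w S"
    and "\<And>x. x \<in> S \<Longrightarrow> w x = v x" "\<And>x. x \<in> S \<Longrightarrow> v x \<le> 2 * g x" "sum v S = f (S \<union> R)"
    and "prices_removal f (set ys) g (S \<union> R)" "prices_addition I f (set xs) (set ys) w (S \<union> R)"
  shows "certified I f xs ys (S, R, v)"
  using assms unfolding certified_def by blast

lemma certified_initial: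
  assumes "matroid N I" "f {} = 0"
  shows "certified I f [] ys ({}, {}, v)"
  using assms
  by (auto simp: certified_def heaviest_def prices_removal_def prices_addition_def matroid_def)

text \<open>A swap preserves \<open>v x \<le> 2 * g x\<close> because the newcomer's marginal value exceeds the value of the
  element that it displaces.\<close>

lemma certified_step:
  assumes M: "matroid N I" and mono: "mono_on (Pow N) f"
    and order: "weak_submodular_order N f (xs @ j # ys)"
    and step: "mls_step N I f j s s'" and cert: "certified I f xs (j # ys) s"
  shows "certified I f (xs @ [j]) ys s'"
proof -
  obtain S R v where s: "s = (S, R, v)" by (cases s)
  let ?A = "S \<union> R" let ?m = "marginal f {j} (S \<union> R)"
  obtain g w where R: "R \<subseteq> set xs" and hv: "heaviest I (set xs) w S"
    and eq: "\<And>x. x \<in> S \<Longrightarrow> w x = v x" "\<And>x. x \<in> S \<Longrightarrow> v x \<le> 2 * g x" and sv: "sum v S = f ?A"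
    and pr: "prices_removal f (set (j # ys)) g ?A"
    and pa: "prices_addition I f (set xs) (set (j # ys)) w ?A"
    using cert unfolding certified_def s by auto
  have jx: "j \<notin> set xs" and N: "N = set (xs @ j # ys)"
    using order by (auto simp: weak_submodular_order_def permutations_of_set_def)
  have S: "S \<in> I" "S \<subseteq> set xs" using hv by (auto simp: heaviest_def)
  then have A: "?A \<subseteq> set xs" using R by auto
  have fS: "finite S" using matroid_finite[OF M S(1)] .
  have jA: "j \<notin> S" "j \<notin> R" using jx A by auto
  have m0: "0 \<le> ?m"
    using mono_onD[OF mono, of ?A "insert j ?A"] A N by (auto simp: marginal_def)
  let ?g = "g(j := ?m)"
  have pr0: "prices_removal f (set ys) g ?A" using pr by (auto simp: prices_removal_def)
  have pr': "prices_removal f (set ys) ?g (insert j ?A)"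
    using prices_removal_accept[OF order A pr] .
  have hv': "heaviest I (set xs) (w(j := x)) S" for x
    using jx by (intro heaviest_cong[OF hv]) auto
  have pa': "prices_addition I f (insert j (set xs)) (set ys) (w(j := x)) (insert j ?A)" for x
    using prices_addition_accept[of I f "set xs" j "set ys" w ?A] pa jx by simp
  have arg: "is_arg_min (w(j := x)) (\<lambda>i. i \<in> C - {j}) i"
    if "is_arg_min v (\<lambda>i. i \<in> C - {j}) i" "C \<subseteq> insert j S" for x C i
  proof -
    have "(w(j := x)) y = v y" if "y \<in> C - {j}" for y
      using that \<open>C \<subseteq> insert j S\<close> eq(1) by auto
    then show ?thesis using that(1) by (simp add: is_arg_min_linorder)
  qed
  have argS: "i \<in> S" "i \<noteq> j" if "is_arg_min v (\<lambda>i. i \<in> C - {j}) i" "C \<subseteq> insert j S" for C i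
    using that by (auto simp: is_arg_min_def)
  show ?thesis
    using step unfolding s
  proof cases
    case add
    have hv'': "heaviest I (insert j (set xs)) (w(j := ?m)) (insert j S)"
      using heaviest_add[OF M hv' jx add(2)] m0 by simp
    have sv': "sum (v(j := ?m)) (insert j S) = f (insert j ?A)"
    proof -
      have "sum (v(j := ?m)) S = sum v S" using jA by (intro sum.cong) auto
      then show ?thesis using fS jA sv by (simp add: marginal_def)
    qed
    have A': "insert j S \<union> R = insert j ?A" by simp
    show ?thesis
      unfolding add(1)
      by (rule certifiedI[where g = ?g and w = "w(j := ?m)"], unfold A')
        (use R eq m0 jA hv'' sv' pr' pa'[of ?m] in auto)
  next
    case (swap C i)
    note i = argS[OF swap(5,4)]
    let ?x = "v i + ?m"
    have hv'': "heaviest I (insert j (set xs)) (w(j := ?x)) (insert j (S - {i}))"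
      using heaviest_swap[OF M hv' swap(3,4) arg[OF swap(5,4)] _ jx swap(2), of ?x] i eq(1)[of i] m0
      by simp
    have sv': "sum (v(j := ?x)) (insert j (S - {i})) = f (insert j ?A)"
    proof -
      have "sum (v(j := ?x)) (S - {i}) = sum v (S - {i})" using jA by (intro sum.cong) auto
      then show ?thesis using fS jA sv i by (simp add: marginal_def sum_diff1)
    qed
    have A': "insert j (S - {i}) \<union> insert i R = insert j ?A" using i by auto
    show ?thesis
      unfolding swap(1)
      by (rule certifiedI[where g = ?g and w = "w(j := ?x)"], unfold A')
        (use R eq swap(6) jA i S hv'' sv' pr' pa'[of ?x] in auto)
  next
    case (reject C i)
    note i = argS[OF reject(5,4)]
    have hv'': "heaviest I (insert j (set xs)) (w(j := v i)) S"
      using heaviest_reject[OF M hv' reject(3,4) arg[OF reject(5,4)], of "v i"] i eq(1)[of i] by simp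
    have pa'': "prices_addition I f (insert j (set xs)) (set ys) (w(j := v i)) ?A"
      using prices_addition_reject[OF M order A pa] reject(6) by simp
    show ?thesis
      unfolding reject(1)
      by (rule certifiedI[where g = g and w = "w(j := v i)"])
        (use R eq sv jA hv'' pr0 pa'' in auto)
  next
    case loop
    have hv'': "heaviest I (insert j (set xs)) (w(j := 0)) S"
      using heaviest_loop[OF M hv' loop(3)] .
    have pa'': "prices_addition I f (insert j (set xs)) (set ys) (w(j := 0)) ?A"
      using prices_addition_reject[OF M order A pa] loop(3) by (simp add: circuit_def)
    show ?thesis
      unfolding loop(1)
      by (rule certifiedI[where g = g and w = "w(j := 0)"])
        (use R eq sv jA hv'' pr0 pa'' in auto)
  qed
qed

lemma certified_steps:
  assumes "matroid N I" "mono_on (Pow N) f"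
    and "mls_steps N I f ys s s'" "weak_submodular_order N f (xs @ ys)" "certified I f xs ys s"
  shows "certified I f (xs @ ys) [] s'"
  using assms(3-5)
proof (induction arbitrary: xs rule: mls_steps.induct)
  case (Cons j s s' js s'')
  have "certified I f (xs @ [j]) js s'"
    using certified_step[OF assms(1,2) Cons.prems(1) Cons.hyps(1) Cons.prems(2)] .
  then show ?case using Cons.IH[of "xs @ [j]"] Cons.prems(1) by simp
qed simp

lemma certified_guarantee:
  assumes M: "matroid N I" and mono: "mono_on (Pow N) f" and \<pi>: "set \<pi> = N"
    and cert: "certified I f \<pi> [] (S, R, v)" and T: "T \<in> I"
  shows "f T \<le> 4 * f S"
proof -
  let ?A = "S \<union> R"
  obtain g w where R: "R \<subseteq> N" and hv: "heaviest I N w S"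
    and eq: "\<And>x. x \<in> S \<Longrightarrow> w x = v x" "\<And>x. x \<in> S \<Longrightarrow> v x \<le> 2 * g x" and sv: "sum v S = f ?A"
    and pr: "prices_removal f {} g ?A" and pa: "prices_addition I f N {} w ?A"
    using cert \<pi> unfolding certified_def by auto
  have S: "S \<in> I" "S \<subseteq> N" using hv by (auto simp: heaviest_def)
  have TN: "T \<subseteq> N" using M T by (auto simp: matroid_def)
  have fA: "finite ?A" using \<pi> R S by (metis List.finite_set Un_least finite_subset)
  have "f ?A \<le> f S + f ?A / 2"
  proof -
    have "f ?A \<le> f (?A - (R - S)) + sum g (R - S)"
      using prices_removalD[OF pr, of "R - S" "{}"] by auto
    moreover have "?A - (R - S) = S" by auto
    moreover have "sum g ?A = sum g S + sum g (R - S)"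
      using fA sum.union_disjoint[of S "R - S" g] by simp
    moreover have "f ?A \<le> 2 * sum g S"
      unfolding sv[symmetric] sum_distrib_left using eq(2) by (rule sum_mono)
    ultimately show ?thesis using pr by (simp add: prices_removal_def)
  qed
  moreover have "f T \<le> 2 * f ?A"
  proof -
    have Q: "T - ?A \<in> I" "T - ?A \<subseteq> N" using matroid_subset[OF M T] TN by auto
    have "f T \<le> f (?A \<union> (T - ?A))" using mono R S TN by (auto simp: mono_on_def)
    also have "\<dots> \<le> f ?A + sum w (T - ?A)"
      using prices_additionD[OF pa Q(1), of "{}"] TN by auto
    also have "sum w (T - ?A) \<le> sum w S" using hv Q by (auto simp: heaviest_def)
    also have "sum w S = f ?A" using sv eq(1) by (simp cong: sum.cong)
    finally show ?thesis by simp
  qed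
  ultimately show ?thesis by simp
qed

section \<open>The query program\<close>

lemma outcomes_bind:
  "outcomes f I (bind_prog p h) =
     (\<Union>(r, q)\<in>outcomes f I p. (\<lambda>(s, q'). (s, q + q')) ` outcomes f I (h r))"
  by (induction p) (simp_all add: case_prod_unfold image_UN image_image, blast)

lemma outcomes_query_marginal: "outcomes f I (query_marginal j A) = {(marginal f {j} A, 2)}"
  by (simp add: query_marginal_def marginal_def)

lemma outcomes_query_circuit:
  "outcomes f I (query_circuit is j S) =
     {(insert j {i \<in> set is. insert j (S - {i}) \<in> I}, length is)}"
  by (induction "is") (auto simp: outcomes_bind)

lemma outcomes_step_add:
  assumes "insert j S \<in> I"
  shows "outcomes f I (mls_step_prog \<pi> j (S, R, v)) =
    {((insert j S, R, v(j := marginal f {j} (S \<union> R))), 3)}"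
  using assms by (simp add: mls_step_prog_def outcomes_bind outcomes_query_marginal)

lemma outcomes_step_circuit:
  assumes M: "matroid N I" and S: "S \<in> I" "insert j S \<notin> I" and C: "circuit N I C" "C \<subseteq> insert j S"
    and \<pi>: "distinct \<pi>" "set \<pi> = N"
  shows "outcomes f I (mls_step_prog \<pi> j (S, R, v)) =
    (if C = {j} then {((S, R, v), card S + 1)}
     else (\<lambda>i. (if marginal f {j} (S \<union> R) > v i
                then (insert j (S - {i}), insert i R, v(j := v i + marginal f {j} (S \<union> R)))
                else (S, R, v), card S + 3)) ` {i. is_arg_min v (\<lambda>i. i \<in> C - {j}) i})"
proof -
  have "S \<subseteq> N" using M S by (auto simp: matroid_def)
  then have set: "set (filter (\<lambda>i. i \<in> S) \<pi>) = S" using \<pi> by auto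
  then have len: "length (filter (\<lambda>i. i \<in> S) \<pi>) = card S"
    using \<pi> by (metis distinct_card distinct_filter)
  have "outcomes f I (query_circuit (filter (\<lambda>i. i \<in> S) \<pi>) j S) = {(C, card S)}"
    unfolding outcomes_query_circuit set len using fundamental_circuit_eq[OF M S(1) C S(2)] by simp
  then show ?thesis
    using S(2) by (simp add: mls_step_prog_def outcomes_bind outcomes_query_marginal image_UN image_image
        UNION_singleton_eq_range numeral_3_eq_3)
qed

lemma mls_step_indep:
  assumes "matroid N I" "mls_step N I f j s s'" "fst s \<in> I"
  shows "fst s' \<in> I"
  using assms(2)
proof cases
  case (swap S C v i R)
  then have "i \<in> C - {j}" by (simp add: is_arg_min_def)
  then show ?thesis
    using fundamental_circuit_eq[OF assms(1) _ swap(4,5,3)] swap assms(3) by auto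
qed (use assms in auto)

lemma mls_step_add_iff:
  assumes "insert j S \<in> I"
  shows "mls_step N I f j (S, R, v) s' \<longleftrightarrow> s' = (insert j S, R, v(j := marginal f {j} (S \<union> R)))"
proof
  assume "mls_step N I f j (S, R, v) s'"
  then show "s' = (insert j S, R, v(j := marginal f {j} (S \<union> R)))"
    by cases (simp_all add: assms)
qed (simp add: assms mls_step.add)

lemma mls_step_circuit_iff:
  assumes M: "matroid N I" and S: "S \<in> I" "insert j S \<notin> I" and C: "circuit N I C" "C \<subseteq> insert j S"
  shows "mls_step N I f j (S, R, v) s' \<longleftrightarrow>
    (if C = {j} then s' = (S, R, v)
     else \<exists>i. is_arg_min v (\<lambda>i. i \<in> C - {j}) i \<and>
       s' = (if marginal f {j} (S \<union> R) > v i
             then (insert j (S - {i}), insert i R, v(j := v i + marginal f {j} (S \<union> R)))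
             else (S, R, v)))" (is "_ \<longleftrightarrow> ?rhs")
proof
  have uniq: "C' = C" if "circuit N I C'" "C' \<subseteq> insert j S" for C'
    using fundamental_circuit_eq[OF M S(1) that S(2)] fundamental_circuit_eq[OF M S(1) C S(2)]
    by simp
  assume "mls_step N I f j (S, R, v) s'"
  then show ?rhs
  proof cases
    case add
    then show ?thesis using S by simp
  next
    case (swap C' i)
    moreover have "C' = C" "C \<noteq> {j}"
      using uniq[OF swap(3,4)] swap(5) by (auto simp: is_arg_min_def)
    ultimately show ?thesis by auto
  next
    case (reject C' i)
    moreover have "C' = C" "C \<noteq> {j}"
      using uniq[OF reject(3,4)] reject(5) by (auto simp: is_arg_min_def)
    ultimately show ?thesis by auto
  next
    case loop
    then show ?thesis using uniq[of "{j}"] by simp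
  qed
next
  assume r: ?rhs
  show "mls_step N I f j (S, R, v) s'"
  proof (cases "C = {j}")
    case True
    then show ?thesis using r mls_step.loop[OF S(2)] C by simp
  next
    case False
    then obtain i where "is_arg_min v (\<lambda>i. i \<in> C - {j}) i"
      and "s' = (if marginal f {j} (S \<union> R) > v i
             then (insert j (S - {i}), insert i R, v(j := v i + marginal f {j} (S \<union> R)))
             else (S, R, v))"
      using r by auto
    then show ?thesis
      using mls_step.swap[OF S(2) C, of v i f R] mls_step.reject[OF S(2) C, of v i f R] by presburger
  qed
qed

text \<open>The number of queries of a step is the same for all outcomes of its choices, so the set of
  outcomes is a product.\<close>

lemma step_prog_correct:
  assumes M: "matroid N I" and S: "fst s \<in> I" and j: "j \<in> N" and \<pi>: "distinct \<pi>" "set \<pi> = N"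
  shows "(\<exists>s'. mls_step N I f j s s') \<and>
    (\<exists>q\<le>matroid_rank I + 3. outcomes f I (mls_step_prog \<pi> j s) = {s'. mls_step N I f j s s'} \<times> {q})"
proof -
  obtain S R v where s: "s = (S, R, v)" by (cases s)
  have SI: "S \<in> I" using S s by simp
  have fS: "finite S" using matroid_finite[OF M SI] .
  have rk: "card S \<le> matroid_rank I" using card_le_matroid_rank[OF M SI] .
  show ?thesis
  proof (cases "insert j S \<in> I")
    case True
    then show ?thesis
      unfolding s outcomes_step_add[OF True] mls_step_add_iff[OF True]
      by (intro conjI exI[of _ 3]) auto
  next
    case False
    have "insert j S \<subseteq> N" using M SI j by (auto simp: matroid_def)
    then obtain C where C: "circuit N I C" "C \<subseteq> insert j S"
      using exists_circuit[of "insert j S" N I] fS False by auto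
    note out = outcomes_step_circuit[OF M SI False C \<pi>, of f R v]
    note step = mls_step_circuit_iff[OF M SI False C, of f R v]
    show ?thesis
    proof (cases "C = {j}")
      case True
      then show ?thesis using rk unfolding s out step by (intro conjI exI[of _ "card S + 1"]) auto
    next
      case noloop: False
      have "finite (C - {j})" using C fS by (meson finite_Diff finite_insert finite_subset)
      moreover have "C - {j} \<noteq> {}" using circuit_contains_new[OF M SI C] noloop by auto
      ultimately obtain i where i: "is_arg_min v (\<lambda>i. i \<in> C - {j}) i"
        using ex_is_arg_min_if_finite by blast
      have "\<exists>s'. mls_step N I f j (S, R, v) s'"
        unfolding step using i noloop by (simp only: if_False) blast
      moreover have "outcomes f I (mls_step_prog \<pi> j (S, R, v)) =
          {s'. mls_step N I f j (S, R, v) s'} \<times> {card S + 3}"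
        unfolding out step using noloop by (simp only: if_False) blast
      ultimately show ?thesis
        using rk unfolding s by (intro conjI exI[of _ "card S + 3"]) simp_all
    qed
  qed
qed

lemma mls_steps_Cons_iff:
  "mls_steps N I f (j # js) s s'' \<longleftrightarrow> (\<exists>s'. mls_step N I f j s s' \<and> mls_steps N I f js s' s'')"
  by (subst mls_steps.simps) auto

lemma steps_prog_correct:
  assumes M: "matroid N I" and \<pi>: "distinct \<pi>" "set \<pi> = N"
    and "set js \<subseteq> N" "fst s \<in> I"
  shows "fst ` outcomes f I (mls_steps_prog \<pi> js s) = {s'. mls_steps N I f js s s'} \<and>
    outcomes f I (mls_steps_prog \<pi> js s) \<noteq> {} \<and>
    (\<forall>(s', q) \<in> outcomes f I (mls_steps_prog \<pi> js s). q \<le> length js * (matroid_rank I + 3))"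
  using assms(4,5)
proof (induction js arbitrary: s)
  case Nil
  then show ?case by (subst mls_steps.simps) auto
next
  case (Cons j js)
  have j: "j \<in> N" using Cons.prems by simp
  obtain q1 where q1: "q1 \<le> matroid_rank I + 3"
    and out: "outcomes f I (mls_step_prog \<pi> j s) = {s'. mls_step N I f j s s'} \<times> {q1}"
    and ex: "\<exists>s'. mls_step N I f j s s'"
    using step_prog_correct[OF M Cons.prems(2) j \<pi>] by blast
  have IH: "fst ` outcomes f I (mls_steps_prog \<pi> js s') = {s''. mls_steps N I f js s' s''}"
      "outcomes f I (mls_steps_prog \<pi> js s') \<noteq> {}"
      "\<And>s'' q. (s'', q) \<in> outcomes f I (mls_steps_prog \<pi> js s') \<Longrightarrow> q \<le> length js * (matroid_rank I + 3)"
    if "mls_step N I f j s s'" for s'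
    using Cons.IH[of s'] mls_step_indep[OF M that Cons.prems(2)] Cons.prems(1) by auto
  have "fst ` outcomes f I (mls_steps_prog \<pi> (j # js) s) =
      (\<Union>s'\<in>fst ` outcomes f I (mls_step_prog \<pi> j s). fst ` outcomes f I (mls_steps_prog \<pi> js s'))"
    by (simp add: outcomes_bind image_UN image_image case_prod_unfold)
  also have "\<dots> = (\<Union>s'\<in>{s'. mls_step N I f j s s'}. {s''. mls_steps N I f js s' s''})"
    using IH(1) by (auto simp: out)
  also have "\<dots> = {s''. mls_steps N I f (j # js) s s''}"
    by (auto simp: mls_steps_Cons_iff)
  finally have 1: "fst ` outcomes f I (mls_steps_prog \<pi> (j # js) s) = \<dots>" .
  have 2: "outcomes f I (mls_steps_prog \<pi> (j # js) s) \<noteq> {}"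
  proof -
    obtain s' where "mls_step N I f j s s'" using ex by blast
    moreover obtain r where "r \<in> outcomes f I (mls_steps_prog \<pi> js s')"
      using IH(2) calculation by blast
    ultimately show ?thesis by (cases r, cases s') (auto simp: outcomes_bind out)
  qed
  have 3: "q \<le> length (j # js) * (matroid_rank I + 3)"
    if q: "(s'', q) \<in> outcomes f I (mls_steps_prog \<pi> (j # js) s)" for s'' q
  proof -
    obtain s' q2 where "mls_step N I f j s s'"
      "(s'', q2) \<in> outcomes f I (mls_steps_prog \<pi> js s')" "q = q1 + q2"
      using q by (auto simp: outcomes_bind out)
    then show ?thesis using q1 IH(3)[of s' s'' q2] by simp
  qed
  show ?case using 1 2 3 by blast
qed

theorem theorem5:
  "\<exists>c::nat. \<forall>(N :: 'a set) (f :: 'a set \<Rightarrow> real) (\<pi> :: 'a list) (I :: 'a set set) (n::nat) (d::nat).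
     finite N \<and> card N = n \<and>
     mono_on (Pow N) f \<and> subadditive_on N f \<and> f {} = 0 \<and>
     weak_submodular_order N f \<pi> \<and>
     matroid N I \<and> matroid_rank I = d \<and> d \<ge> 1 \<longrightarrow>
       mls_outputs N I f \<pi> \<noteq> {} \<and>
       (\<forall>S \<in> mls_outputs N I f \<pi>. S \<in> I \<and> f S \<ge> 0.25 * Max (f ` I)) \<and>
       fst ` outcomes f I (mls_prog \<pi>) = mls_outputs N I f \<pi> \<and>
       (\<forall>(S, q) \<in> outcomes f I (mls_prog \<pi>). q \<le> c * (n * d))"
  (* Each of the n steps makes at most d + 3 <= 4 * d queries. *)
proof (intro exI[of _ 4] allI impI)
  fix N :: "'a set" and f :: "'a set \<Rightarrow> real" and \<pi> :: "'a list" and I :: "'a set set" and n d :: nat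
  assume asm: "finite N \<and> card N = n \<and>
     mono_on (Pow N) f \<and> subadditive_on N f \<and> f {} = 0 \<and>
     weak_submodular_order N f \<pi> \<and>
     matroid N I \<and> matroid_rank I = d \<and> d \<ge> 1"
  let ?init = "({}, {}, \<lambda>_. 0) :: 'a state"
  have M: "matroid N I" and mono: "mono_on (Pow N) f" and order: "weak_submodular_order N f \<pi>"
    and d: "matroid_rank I = d" "1 \<le> d" and f0: "f {} = 0"
    using asm by auto
  have \<pi>: "distinct \<pi>" "set \<pi> = N"
    using order by (auto simp: weak_submodular_order_def permutations_of_set_def)
  have len: "length \<pi> = n" using asm \<pi> distinct_card by fastforce
  have I0: "{} \<in> I" using M by (auto simp: matroid_def)
  have fI: "finite I" using matroid_finite_indep[OF M] .
  note prog = steps_prog_correct[OF M \<pi>, where js = \<pi> and s = ?init and f = f]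
  have out: "fst ` outcomes f I (mls_prog \<pi>) = mls_outputs N I f \<pi>"
  proof -
    have "fst ` outcomes f I (mls_prog \<pi>) = fst ` fst ` outcomes f I (mls_steps_prog \<pi> \<pi> ?init)"
      by (simp add: mls_prog_def outcomes_bind image_UN image_image case_prod_unfold
          UNION_singleton_eq_range)
    also have "\<dots> = fst ` {s'. mls_steps N I f \<pi> ?init s'}"
      using prog I0 \<pi> by simp
    also have "\<dots> = mls_outputs N I f \<pi>"
      by (force simp: mls_outputs_def)
    finally show ?thesis .
  qed
  have "mls_outputs N I f \<pi> \<noteq> {}"
    using prog I0 \<pi> unfolding out[symmetric]
    by (simp add: mls_prog_def outcomes_bind case_prod_unfold UNION_singleton_eq_range)
  moreover have "S \<in> I \<and> f S \<ge> 0.25 * Max (f ` I)" if S: "S \<in> mls_outputs N I f \<pi>" for S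
  proof -
    obtain R v where "mls_steps N I f \<pi> ?init (S, R, v)" using S by (auto simp: mls_outputs_def)
    then have cert: "certified I f \<pi> [] (S, R, v)"
      using certified_steps[OF M mono, of \<pi> ?init "(S, R, v)" "[]"] order
        certified_initial[where I = I and f = f, OF M f0] by simp
    have "Max (f ` I) \<in> f ` I" using fI I0 by (intro Max_in) auto
    then have "Max (f ` I) \<le> 4 * f S"
      using certified_guarantee[OF M mono \<pi>(2) cert] by auto
    moreover have "S \<in> I" using cert by (auto simp: certified_def heaviest_def)
    ultimately show ?thesis by simp
  qed
  moreover have "q \<le> 4 * (n * d)" if "(S, q) \<in> outcomes f I (mls_prog \<pi>)" for S q
  proof -
    have "q \<le> n * (d + 3)"
      using prog I0 \<pi> that d len by (fastforce simp: mls_prog_def outcomes_bind)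
    also have "\<dots> \<le> n * (4 * d)" using d by (intro mult_left_mono) auto
    finally show ?thesis by (simp add: mult.assoc mult.left_commute)
  qed
  ultimately show "mls_outputs N I f \<pi> \<noteq> {} \<and>
       (\<forall>S \<in> mls_outputs N I f \<pi>. S \<in> I \<and> f S \<ge> 0.25 * Max (f ` I)) \<and>
       fst ` outcomes f I (mls_prog \<pi>) = mls_outputs N I f \<pi> \<and>
       (\<forall>(S, q) \<in> outcomes f I (mls_prog \<pi>). q \<le> 4 * (n * d))"
    using out by auto
qed

end
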